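(* Let $h:\mathbb R^n\to\mathbb R$ be continuously differentiable, let $S=\{x\in\mathbb R^n: h(x)\le 0\}$, and let $0<T<\infty$. Suppose there exist constants $\alpha_1,\alpha_2>0$, $\gamma_1>1$ and $0<\gamma_2<1$ satisfying $$\frac{1}{\alpha_1(\gamma_1-1)}+\frac{1}{\alpha_2(1-\gamma_2)}\le T,$$ such that $$\inf_{u\in\mathcal U}\{L_fh(x)+L_gh(x)u\}\le-\alpha_1\max\{0,h(x)\}^{\gamma_1}-\alpha_2\max\{0,h(x)\}^{\gamma_2}$$ for all $x\in\mathbb R^n$. Then, under a control input $u\in\mathcal U$ satisfying this inequality, i.e. $L_fh(x)+L_gh(x)u\le-\alpha_1\max\{0,h(x)\}^{\gamma_1}-\alpha_2\max\{0,h(x)\}^{\gamma_2}$, the closed-loop trajectories of $\dot x=f(x)+g(x)u$ reach the set $S$ within the prescribed time $T$ for all initial conditions $x(0)\in\mathbb R^n$, and stay in $S$ for all future times.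
   Context: Consider the control-affine system $\dot x(t)=f(x(t))+g(x(t))u$, with state $x\in\mathbb R^n$, vector fields $f:\mathbb R^n\to\mathbb R^n$, $g:\mathbb R^n\to\mathbb R^{n\times m}$, and control input $u\in\mathbb R^m$ constrained to $\mathcal U=\{v\in\mathbb R^m : A_uv\le b_u\}$ (componentwise inequality), where $A_u\in\mathbb R^{l\times m}$, $b_u\in\mathbb R^l$ are given. A closed-loop trajectory is a solution $x(t)$, $t\ge 0$, of this system under the chosen control input. $L_fh=\frac{\partial h}{\partial x}f$ and $L_gh=\frac{\partial h}{\partial x}g$ denote Lie derivatives. "Reach $S$ within time $T$" means that the trajectory is in $S$ at some time $t\le T$. *)

theory Defs
  imports "HOL-Analysis.Analysis"
begin

definition continuously_differentiable :: "(real ^ 'n \<Rightarrow> real) \<Rightarrow> bool"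
  where "continuously_differentiable h \<longleftrightarrow>
    (\<exists>h' :: real ^ 'n \<Rightarrow> (real ^ 'n) \<Rightarrow>\<^sub>L real.
      (\<forall>x. (h has_derivative blinfun_apply (h' x)) (at x)) \<and> continuous_on UNIV h')"

definition lie_deriv :: "(real ^ 'n \<Rightarrow> real ^ 'n) \<Rightarrow> (real ^ 'n \<Rightarrow> real) \<Rightarrow> real ^ 'n \<Rightarrow> real"
  where "lie_deriv f h x = frechet_derivative h (at x) (f x)"

text \<open>For a matrix field \<open>g\<close>, \<open>L\<^sub>g h\<close> is the row vector whose entries are the Lie derivatives along
  the columns of \<open>g\<close>; the product \<open>L\<^sub>g h(x) u\<close> is then the inner product of this vector with \<open>u\<close>.\<close>

definition lie_deriv_mat ::
    "(real ^ 'n \<Rightarrow> real ^ 'm ^ 'n) \<Rightarrow> (real ^ 'n \<Rightarrow> real) \<Rightarrow> real ^ 'n \<Rightarrow> real ^ 'm"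
  where "lie_deriv_mat g h x = (\<chi> j. lie_deriv (\<lambda>y. column j (g y)) h x)"

text \<open>The order on \<^typ>\<open>real ^ 'l\<close> is the componentwise one.\<close>

definition input_set :: "real ^ 'm ^ 'l \<Rightarrow> real ^ 'l \<Rightarrow> (real ^ 'm) set"
  where "input_set A b = {v. A *v v \<le> b}"

text \<open>Solutions are classical: differentiable at every \<open>t \<ge> 0\<close>, one-sidedly at \<open>t = 0\<close>. The input is
  given by its values \<open>u t\<close> along the trajectory; a feedback law \<open>k\<close> is the case
  \<open>u t = k (x t)\<close>.\<close>

definition trajectory ::
    "(real ^ 'n \<Rightarrow> real ^ 'n) \<Rightarrow> (real ^ 'n \<Rightarrow> real ^ 'm ^ 'n) \<Rightarrow> (real \<Rightarrow> real ^ 'm) \<Rightarrow>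
      (real \<Rightarrow> real ^ 'n) \<Rightarrow> bool"
  where "trajectory f g u x \<longleftrightarrow>
    (\<forall>t\<ge>0. (x has_vector_derivative f (x t) + g (x t) *v u t) (at t within {0..}))"

definition reaches_within :: "'a set \<Rightarrow> real \<Rightarrow> (real \<Rightarrow> 'a) \<Rightarrow> bool"
  where "reaches_within S T x \<longleftrightarrow> (\<exists>t\<in>{0..T}. x t \<in> S)"

definition stays_in :: "'a set \<Rightarrow> (real \<Rightarrow> 'a) \<Rightarrow> bool"
  where "stays_in S x \<longleftrightarrow> (\<forall>t\<ge>0. x t \<in> S \<longrightarrow> (\<forall>s\<ge>t. x s \<in> S))"

end

theory Submission imports Defs begin

text \<open>Along a trajectory, \<open>v t = h (x t)\<close> satisfies \<open>v' \<le> - \<alpha>\<^sub>1 v powr \<gamma>\<^sub>1 - \<alpha>\<^sub>2 v powr \<gamma>\<^sub>2\<close> while it is positive, and it is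
  never increasing, so \<open>S\<close> is invariant. Separating variables in \<open>v' \<le> - \<alpha>\<^sub>1 v powr \<gamma>\<^sub>1\<close> shows that \<open>v\<close> falls below
  \<open>1\<close> by time \<open>1 / (\<alpha>\<^sub>1 (\<gamma>\<^sub>1 - 1))\<close> regardless of \<open>v 0\<close>, since \<open>\<gamma>\<^sub>1 > 1\<close>; from then on \<open>v' \<le> - \<alpha>\<^sub>2 v powr \<gamma>\<^sub>2\<close> with
  \<open>\<gamma>\<^sub>2 < 1\<close> brings it from \<open>1\<close> to \<open>0\<close> within another \<open>1 / (\<alpha>\<^sub>2 (1 - \<gamma>\<^sub>2))\<close>.\<close>

text \<open>The derivative is taken within \<open>{a..}\<close> to match trajectories, which are
  differentiable only from the right at time 0. At points beyond \<open>a\<close> it is two-sided;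
  at \<open>a\<close> itself only continuity is used.\<close>

lemma nonincreasing_on_atLeast:
  fixes v :: "real \<Rightarrow> real"
  assumes "\<And>t. t \<ge> a \<Longrightarrow> \<exists>d\<le>0. (v has_real_derivative d) (at t within {a..})"
    and "a \<le> s" "s \<le> t"
  shows "v t \<le> v s"
proof (rule DERIV_nonpos_imp_decreasing_open[OF \<open>s \<le> t\<close>])
  fix r assume "s < r" "r < t"
  then have "at r within {a..} = at r"
    using \<open>a \<le> s\<close> by (intro at_within_interior) auto
  then show "\<exists>d. (v has_real_derivative d) (at r) \<and> d \<le> 0"
    using assms(1)[of r] \<open>a \<le> s\<close> \<open>s < r\<close> by auto
next
  have "continuous_on {a..} v"
    unfolding continuous_on_eq_continuous_within
    using assms(1) by (meson atLeast_iff DERIV_continuous)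
  then show "continuous_on {s..t} v"
    by (rule continuous_on_subset) (use \<open>a \<le> s\<close> in auto)
qed

text \<open>Separation of variables: \<open>v powr (1 - \<gamma>) / (1 - \<gamma>)\<close> has
  derivative \<open>v powr (- \<gamma>) * v'\<close>, which is at most \<open>- \<alpha>\<close>.
  Dividing by \<open>1 - \<gamma>\<close> gives one inequality that serves both \<gamma> > 1 and
  \<gamma> < 1. Positivity of \<open>v\<close> keeps the powers differentiable.\<close>

lemma powr_decay:
  fixes v :: "real \<Rightarrow> real"
  assumes "s \<le> t" and "\<gamma> \<noteq> 1"
    and pos: "\<And>r. r \<in> {s..t} \<Longrightarrow> v r > 0"
    and cont: "continuous_on {s..t} v"
    and deriv: "\<And>r. r \<in> {s<..<t} \<Longrightarrow>
      \<exists>d. (v has_real_derivative d) (at r) \<and> d \<le> - \<alpha> * v r powr \<gamma>"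
  shows "v t powr (1 - \<gamma>) / (1 - \<gamma>) + \<alpha> * (t - s) \<le> v s powr (1 - \<gamma>) / (1 - \<gamma>)"
proof -
  define w where "w r = v r powr (1 - \<gamma>) / (1 - \<gamma>) + \<alpha> * (r - s)" for r
  have "w t \<le> w s"
  proof (rule DERIV_nonpos_imp_decreasing_open[OF \<open>s \<le> t\<close>])
    fix r assume r: "s < r" "r < t"
    then obtain d where d: "(v has_real_derivative d) (at r)" "d \<le> - \<alpha> * v r powr \<gamma>"
      using deriv[of r] by auto
    have "v r > 0" using pos r by auto
    then have "(w has_real_derivative (v r powr (- \<gamma>) * d + \<alpha>)) (at r)"
      unfolding w_def using \<open>\<gamma> \<noteq> 1\<close> d(1)
      by (auto intro!: derivative_eq_intros)
    moreover have "v r powr (- \<gamma>) * d \<le> v r powr (- \<gamma>) * (- \<alpha> * v r powr \<gamma>)"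
      by (intro mult_left_mono d(2)) simp
    then have "v r powr (- \<gamma>) * d + \<alpha> \<le> 0"
      using \<open>v r > 0\<close> by (simp add: powr_minus field_simps)
    ultimately show "\<exists>d. (w has_real_derivative d) (at r) \<and> d \<le> 0" by blast
  next
    show "continuous_on {s..t} w"
      unfolding w_def using pos \<open>\<gamma> \<noteq> 1\<close>
      by (intro continuous_intros cont) (auto simp: less_imp_neq[symmetric])
  qed
  then show ?thesis by (simp add: w_def)
qed

lemma fixed_time_decay:
  fixes v :: "real \<Rightarrow> real"
  assumes \<alpha>: "\<alpha>\<^sub>1 > 0" "\<alpha>\<^sub>2 > 0" and \<gamma>: "\<gamma>\<^sub>1 > 1" "\<gamma>\<^sub>2 < 1"
    and T: "1 / (\<alpha>\<^sub>1 * (\<gamma>\<^sub>1 - 1)) + 1 / (\<alpha>\<^sub>2 * (1 - \<gamma>\<^sub>2)) \<le> T"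
    and cont: "continuous_on {0..T} v"
    and deriv: "\<And>t. t \<in> {0<..<T} \<Longrightarrow> \<exists>d. (v has_real_derivative d) (at t) \<and>
      d \<le> - \<alpha>\<^sub>1 * max 0 (v t) powr \<gamma>\<^sub>1 - \<alpha>\<^sub>2 * max 0 (v t) powr \<gamma>\<^sub>2"
  shows "\<exists>t\<in>{0..T}. v t \<le> 0"
proof (rule ccontr)
  \<comment> \<open>If \<open>v\<close> never reaches 0, it is positive on all of
    \<open>{0..T}\<close>; this removes the \<open>max\<close> and makes \<open>powr_decay\<close>
    applicable on both time intervals.\<close>
  assume "\<not> ?thesis"
  then have pos: "v t > 0" if "t \<in> {0..T}" for t using that by (auto simp: not_le)
  define t\<^sub>1 where "t\<^sub>1 = 1 / (\<alpha>\<^sub>1 * (\<gamma>\<^sub>1 - 1))"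
  define t\<^sub>2 where "t\<^sub>2 = t\<^sub>1 + 1 / (\<alpha>\<^sub>2 * (1 - \<gamma>\<^sub>2))"
  have t: "0 \<le> t\<^sub>1" "t\<^sub>1 \<le> t\<^sub>2" "t\<^sub>2 \<le> T"
    using \<alpha> \<gamma> T by (simp_all add: t\<^sub>1_def t\<^sub>2_def)
  have d1: "\<exists>d. (v has_real_derivative d) (at r) \<and> d \<le> - \<alpha>\<^sub>1 * v r powr \<gamma>\<^sub>1"
    and d2: "\<exists>d. (v has_real_derivative d) (at r) \<and> d \<le> - \<alpha>\<^sub>2 * v r powr \<gamma>\<^sub>2"
    if "r \<in> {0<..<T}" for r
  proof -
    have "max 0 (v r) = v r" using pos[of r] that by auto
    moreover have "\<alpha>\<^sub>1 * v r powr \<gamma>\<^sub>1 \<ge> 0" "\<alpha>\<^sub>2 * v r powr \<gamma>\<^sub>2 \<ge> 0" using \<alpha> by simp_all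
    ultimately show "\<exists>d. (v has_real_derivative d) (at r) \<and> d \<le> - \<alpha>\<^sub>1 * v r powr \<gamma>\<^sub>1"
      "\<exists>d. (v has_real_derivative d) (at r) \<and> d \<le> - \<alpha>\<^sub>2 * v r powr \<gamma>\<^sub>2"
      using deriv[OF that] by force+
  qed
  have "v t\<^sub>1 powr (1 - \<gamma>\<^sub>1) / (1 - \<gamma>\<^sub>1) + \<alpha>\<^sub>1 * (t\<^sub>1 - 0) \<le> v 0 powr (1 - \<gamma>\<^sub>1) / (1 - \<gamma>\<^sub>1)"
    using t \<gamma> by (intro powr_decay continuous_on_subset[OF cont] pos d1) auto
  \<comment> \<open>The dependence on \<open>v 0\<close> disappears here: since
    \<open>1 - \<gamma>\<^sub>1\<close> is negative, the initial term is negative however large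
    \<open>v 0\<close> is.\<close>
  also have "\<dots> < 0" using \<gamma> pos[of 0] t by (simp add: divide_pos_neg)
  also have "\<alpha>\<^sub>1 * (t\<^sub>1 - 0) = 1 / (\<gamma>\<^sub>1 - 1)" using \<alpha> by (simp add: t\<^sub>1_def)
  finally have "v t\<^sub>1 powr (1 - \<gamma>\<^sub>1) / (1 - \<gamma>\<^sub>1) < 1 / (1 - \<gamma>\<^sub>1)"
    using minus_divide_right[of 1 "\<gamma>\<^sub>1 - 1"] by simp
  then have "v t\<^sub>1 powr (1 - \<gamma>\<^sub>1) > 1" using \<gamma> by (simp add: divide_less_cancel)
  \<comment> \<open>The exponent \<open>1 - \<gamma>\<^sub>1\<close> is negative, so a base of at
    least 1 would give a power of at most 1.\<close>
  then have "v t\<^sub>1 < 1"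
    using \<gamma> ge_one_powr_ge_zero[of "v t\<^sub>1" "\<gamma>\<^sub>1 - 1"] powr_minus_divide[of "v t\<^sub>1" "\<gamma>\<^sub>1 - 1"]
    by (fastforce simp: not_le[symmetric] divide_le_eq)
  have "v t\<^sub>2 powr (1 - \<gamma>\<^sub>2) / (1 - \<gamma>\<^sub>2) + \<alpha>\<^sub>2 * (t\<^sub>2 - t\<^sub>1) \<le> v t\<^sub>1 powr (1 - \<gamma>\<^sub>2) / (1 - \<gamma>\<^sub>2)"
    using t \<gamma> by (intro powr_decay continuous_on_subset[OF cont] pos d2) auto
  also have "\<dots> \<le> 1 / (1 - \<gamma>\<^sub>2)"
    using \<gamma> \<open>v t\<^sub>1 < 1\<close> pos[of t\<^sub>1] t by (intro divide_right_mono powr_le1) auto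
  \<comment> \<open>The second interval is just long enough to use up the whole bound, leaving no
    room for a positive power at \<open>t\<^sub>2\<close>.\<close>
  also have "\<alpha>\<^sub>2 * (t\<^sub>2 - t\<^sub>1) = 1 / (1 - \<gamma>\<^sub>2)" using \<alpha> by (simp add: t\<^sub>2_def)
  finally have "v t\<^sub>2 powr (1 - \<gamma>\<^sub>2) / (1 - \<gamma>\<^sub>2) \<le> 0" by simp
  then have "v t\<^sub>2 powr (1 - \<gamma>\<^sub>2) \<le> 0" using \<gamma> by (simp add: divide_le_0_iff)
  moreover have "v t\<^sub>2 > 0" using pos t by simp
  ultimately show False by simp
qed

text \<open>Write \<open>g x *v u\<close> as the combination of the columns of \<open>g x\<close>
  with coefficients the entries of \<open>u\<close>, and apply linearity of the derivative.\<close>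

lemma frechet_derivative_control_affine:
  assumes "h differentiable (at x)"
  shows "frechet_derivative h (at x) (f x + g x *v u) = lie_deriv f h x + lie_deriv_mat g h x \<bullet> u"
proof -
  interpret D: linear "frechet_derivative h (at x)"
    by (rule linear_frechet_derivative[OF assms])
  show ?thesis
    unfolding matrix_mult_sum lie_deriv_mat_def lie_deriv_def inner_vec_def
    by (simp add: D.add D.sum D.scale scalar_mult_eq_scaleR mult.commute)
qed

lemma trajectory_has_real_derivative:
  assumes "continuously_differentiable h" and "trajectory f g u x" and "t \<ge> 0"
  shows "((\<lambda>t. h (x t)) has_real_derivative
    lie_deriv f h (x t) + lie_deriv_mat g h (x t) \<bullet> u t) (at t within {0..})"
proof -
  have diff: "h differentiable (at (x t))"
    using assms(1) unfolding continuously_differentiable_def differentiable_def by blast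
  have "(x has_vector_derivative f (x t) + g (x t) *v u t) (at t within {0..})"
    using assms(2,3) by (simp add: trajectory_def)
  from vector_derivative_diff_chain_within[OF this
      has_derivative_at_withinI[OF diff[unfolded frechet_derivative_works]]]
  show ?thesis
    by (simp add: has_real_derivative_iff_has_vector_derivative o_def
        frechet_derivative_control_affine[OF diff])
qed

theorem corollary1:
  fixes f :: "real ^ 'n \<Rightarrow> real ^ 'n"
    and g :: "real ^ 'n \<Rightarrow> real ^ 'm ^ 'n"
    and A\<^sub>u :: "real ^ 'm ^ 'l"
    and b\<^sub>u :: "real ^ 'l"
    and h :: "real ^ 'n \<Rightarrow> real"
    and T \<alpha>\<^sub>1 \<alpha>\<^sub>2 \<gamma>\<^sub>1 \<gamma>\<^sub>2 :: real
  defines "U \<equiv> input_set A\<^sub>u b\<^sub>u"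
    and "S \<equiv> {x. h x \<le> 0}"
  assumes "continuously_differentiable h"
    and "0 < T"
    and "\<alpha>\<^sub>1 > 0" and "\<alpha>\<^sub>2 > 0" and "\<gamma>\<^sub>1 > 1" and "0 < \<gamma>\<^sub>2" and "\<gamma>\<^sub>2 < 1"
    and "1 / (\<alpha>\<^sub>1 * (\<gamma>\<^sub>1 - 1)) + 1 / (\<alpha>\<^sub>2 * (1 - \<gamma>\<^sub>2)) \<le> T"
    and "\<forall>x. (INF u\<in>U. ereal (lie_deriv f h x + lie_deriv_mat g h x \<bullet> u))
           \<le> ereal (- \<alpha>\<^sub>1 * max 0 (h x) powr \<gamma>\<^sub>1 - \<alpha>\<^sub>2 * max 0 (h x) powr \<gamma>\<^sub>2)"
  shows "\<forall>x u. trajectory f g u x \<longrightarrow>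
           (\<forall>t\<ge>0. u t \<in> U \<and>
              lie_deriv f h (x t) + lie_deriv_mat g h (x t) \<bullet> u t
                \<le> - \<alpha>\<^sub>1 * max 0 (h (x t)) powr \<gamma>\<^sub>1 - \<alpha>\<^sub>2 * max 0 (h (x t)) powr \<gamma>\<^sub>2) \<longrightarrow>
           reaches_within S T x \<and> stays_in S x"
proof (intro allI impI conjI)
  fix x u
  assume traj: "trajectory f g u x"
    and u: "\<forall>t\<ge>0. u t \<in> U \<and>
      lie_deriv f h (x t) + lie_deriv_mat g h (x t) \<bullet> u t
        \<le> - \<alpha>\<^sub>1 * max 0 (h (x t)) powr \<gamma>\<^sub>1 - \<alpha>\<^sub>2 * max 0 (h (x t)) powr \<gamma>\<^sub>2"
  let ?v = "\<lambda>t. h (x t)"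
  let ?d = "\<lambda>t. lie_deriv f h (x t) + lie_deriv_mat g h (x t) \<bullet> u t"
  note deriv = trajectory_has_real_derivative[OF assms(3) traj]
  \<comment> \<open>The bound on the derivative is nonpositive inside \<open>S\<close> as well as
    outside, so \<open>h\<close> cannot rise along the trajectory even after \<open>S\<close> is
    reached.\<close>
  have "?d t \<le> 0" if "t \<ge> 0" for t
  proof -
    have "\<alpha>\<^sub>1 * max 0 (?v t) powr \<gamma>\<^sub>1 \<ge> 0" "\<alpha>\<^sub>2 * max 0 (?v t) powr \<gamma>\<^sub>2 \<ge> 0"
      using assms(5,6) by simp_all
    then show ?thesis using u that by fastforce
  qed
  then have "?v t \<le> ?v s" if "0 \<le> s" "s \<le> t" for s t
    using nonincreasing_on_atLeast[of 0 ?v s t] deriv that by blast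
  then show "stays_in S x"
    unfolding stays_in_def S_def by (fastforce intro: order_trans)
  have "\<exists>t\<in>{0..T}. ?v t \<le> 0"
  proof (rule fixed_time_decay[OF assms(5,6,7,9,10)])
    show "continuous_on {0..T} ?v"
      unfolding continuous_on_eq_continuous_within
      using deriv by (meson atLeastAtMost_iff atLeast_iff continuous_within_subset
          DERIV_continuous subsetI)
    fix t assume t: "t \<in> {0<..<T}"
    then have "at t within {0..} = at t" by (intro at_within_interior) auto
    with deriv[of t] t have "(?v has_real_derivative ?d t) (at t)" by simp
    with u t show "\<exists>d. (?v has_real_derivative d) (at t) \<and>
        d \<le> - \<alpha>\<^sub>1 * max 0 (?v t) powr \<gamma>\<^sub>1 - \<alpha>\<^sub>2 * max 0 (?v t) powr \<gamma>\<^sub>2"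
      by (meson greaterThanLessThan_iff less_imp_le)
  qed
  then show "reaches_within S T x"
    by (auto simp: reaches_within_def S_def)
qed

end
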